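(* Let $M$ be a finite MDP with trajectory space $\Xi$, feature map $\phi:\mathcal{S}\times\mathcal{A}\to\mathbb{R}^d$ and ground-truth reward parameter $w^\star\in\mathbb{R}^d$. Define \[ H_{\text{comparison}}=\{w\in\mathbb{R}^d:\|w\|_2\le 1,\ w^\top(\Phi(\xi_i)-\Phi(\xi_j))\ge 0\ \ \forall\,\xi_i,\xi_j\in\Xi\text{ with }w^{\star\top}\Phi(\xi_i)>w^{\star\top}\Phi(\xi_j)\}, \] and let corrective feedback induce the feasible region \[ H_{\text{correction}}=\{w\in\mathbb{R}^d:\|w\|_2\le 1,\ w^\top(\Phi(\xi_{\mathrm{corr}})-\Phi(\xi_R))\ge 0\ \ \forall\,\xi_{\mathrm{corr}},\xi_R\in\Xi\text{ with the same initial state and }w^{\star\top}\Phi(\xi_{\mathrm{corr}})>w^{\star\top}\Phi(\xi_R)\}. \] Assume (genericity) that there exist $\xi_i,\xi_j\in\Xi$ with $w^{\star\top}\Phi(\xi_i)>w^{\star\top}\Phi(\xi_j)$ such that the set $H_{\text{correction}}\cap\{w:w^\top(\Phi(\xi_i)-\Phi(\xi_j))<0\}$ has positive Lebesgue measure. Then \[ H_{\text{comparison}}\subsetneq H_{\text{correction}}\quad\text{and}\quad G(H_{\text{comparison}})<G(H_{\text{correction}}). \]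
   Context: A finite MDP (without reward) is a tuple $(\mathcal{S},\mathcal{A},T,\gamma)$ with finite $\mathcal{S},\mathcal{A}$, transition function $T(s'\mid s,a)$ and $\gamma\in(0,1)$. $\Xi$ is the set of all trajectories $\xi=(s_0,a_0,s_1,a_1,\dots)$ that can arise in $M$, and $\Phi(\xi)=\sum_{t=0}^{\infty}\gamma^t\phi(s_t,a_t)\in\mathbb{R}^d$ is the discounted feature vector; the return of $\xi$ under reward parameter $w$ is $w^\top\Phi(\xi)$. A correction is an improved trajectory $\xi_{\mathrm{corr}}$ offered in place of the agent's rollout $\xi_R$, with the same initial state. For a set $H$ contained in the unit ball of $\mathbb{R}^d$, $G(H)$ denotes its volume ($d$-dimensional Lebesgue measure). *)

theory Defs
  imports "HOL-Probability.Probability"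
begin

text \<open>
  The state and action sets are the types \<open>'s\<close> and \<open>'a\<close>, required to be of class \<open>finite\<close>;
  \<open>T(s' | s, a)\<close> is \<open>pmf (trans_prob M s a) s'\<close>.
\<close>

record ('s, 'a) mdp =
  trans_prob :: "'s \<Rightarrow> 'a \<Rightarrow> 's pmf"
  discount :: real

definition finite_mdp :: "('s::finite, 'a::finite) mdp \<Rightarrow> bool" where
  "finite_mdp M \<longleftrightarrow> 0 < discount M \<and> discount M < 1"

type_synonym ('s, 'a) trajectory = "nat \<Rightarrow> 's \<times> 'a"

text \<open>
  There is no initial distribution and no fixed policy: a trajectory can arise if it starts in any
  state, takes any actions, and each of its transitions has positive probability.
\<close>

definition trajectories :: "('s, 'a) mdp \<Rightarrow> ('s, 'a) trajectory set" where
  "trajectories M =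
     {\<xi>. \<forall>t. pmf (trans_prob M (fst (\<xi> t)) (snd (\<xi> t))) (fst (\<xi> (Suc t))) > 0}"

definition initial_state :: "('s, 'a) trajectory \<Rightarrow> 's" where
  "initial_state \<xi> = fst (\<xi> 0)"

definition discounted_features ::
    "('s, 'a) mdp \<Rightarrow> ('s \<times> 'a \<Rightarrow> real ^ 'd) \<Rightarrow> ('s, 'a) trajectory \<Rightarrow> real ^ 'd" where
  "discounted_features M \<phi> \<xi> = (\<Sum>t. discount M ^ t *\<^sub>R \<phi> (\<xi> t))"

definition traj_return ::
    "('s, 'a) mdp \<Rightarrow> ('s \<times> 'a \<Rightarrow> real ^ 'd) \<Rightarrow> real ^ 'd \<Rightarrow> ('s, 'a) trajectory \<Rightarrow> real" where
  "traj_return M \<phi> w \<xi> = w \<bullet> discounted_features M \<phi> \<xi>"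

definition H_comparison ::
    "('s, 'a) mdp \<Rightarrow> ('s \<times> 'a \<Rightarrow> real ^ 'd) \<Rightarrow> real ^ 'd \<Rightarrow> (real ^ 'd) set" where
  "H_comparison M \<phi> wstar =
     {w. norm w \<le> 1 \<and>
         (\<forall>\<xi>i\<in>trajectories M. \<forall>\<xi>j\<in>trajectories M.
            traj_return M \<phi> wstar \<xi>i > traj_return M \<phi> wstar \<xi>j \<longrightarrow>
            w \<bullet> (discounted_features M \<phi> \<xi>i - discounted_features M \<phi> \<xi>j) \<ge> 0)}"

definition H_correction ::
    "('s, 'a) mdp \<Rightarrow> ('s \<times> 'a \<Rightarrow> real ^ 'd) \<Rightarrow> real ^ 'd \<Rightarrow> (real ^ 'd) set" where
  "H_correction M \<phi> wstar =
     {w. norm w \<le> 1 \<and>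
         (\<forall>\<xi>corr\<in>trajectories M. \<forall>\<xi>R\<in>trajectories M.
            initial_state \<xi>corr = initial_state \<xi>R \<and>
            traj_return M \<phi> wstar \<xi>corr > traj_return M \<phi> wstar \<xi>R \<longrightarrow>
            w \<bullet> (discounted_features M \<phi> \<xi>corr - discounted_features M \<phi> \<xi>R) \<ge> 0)}"

text \<open>
  \<open>measure\<close> is 0 on non-measurable sets and on sets of infinite measure. Neither case
  arises for the two regions above: both are closed and bounded.
\<close>

definition G :: "(real ^ 'd) set \<Rightarrow> real" where
  "G H = measure lebesgue H"

end

theory Submission
  imports Defs
begin

text \<open>Corrections impose only those comparison constraints whose two trajectories share an
  initial state, so the comparison region lies inside the correction region. The generic pair
  (necessarily with different initial states) gives an open half-space that misses the comparison
  region but meets the correction region in positive measure. Both regions are compact, so their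
  volumes are finite and subtract: the gap is the measure of the set difference, which is positive.
  Strict inclusion then follows from strict inequality of volumes.\<close>

lemma compact_unit_ball_Int_dual_cone:
  fixes V :: "'v::euclidean_space set"
  shows "compact {w. norm w \<le> 1 \<and> (\<forall>v\<in>V. 0 \<le> w \<bullet> v)}"
proof -
  \<comment> \<open>Closed half-spaces may be intersected in any number, so \<open>V\<close> can be
    uncountable.\<close>
  have "{w. norm w \<le> 1 \<and> (\<forall>v\<in>V. 0 \<le> w \<bullet> v)} = cball 0 1 \<inter> (\<Inter>v\<in>V. {w. 0 \<le> v \<bullet> w})"
    by (auto simp: inner_commute)
  moreover have "closed (\<Inter>v\<in>V. {w. 0 \<le> v \<bullet> w})"
    by (intro closed_INT ballI closed_Collect_le continuous_intros)
  ultimately show ?thesis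
    by (simp add: compact_Int_closed)
qed

text \<open>The constraints depend on trajectory pairs only through their feature differences, which
  serve as \<open>V\<close>. Compactness is what later yields measurability and finite
  volume.\<close>

lemma compact_H_comparison: "compact (H_comparison M \<phi> wstar)"
proof -
  let ?F = "discounted_features M \<phi>" and ?R = "traj_return M \<phi> wstar"
  have "H_comparison M \<phi> wstar = {w. norm w \<le> 1 \<and>
     (\<forall>v\<in>{?F \<xi> - ?F \<xi>' |\<xi> \<xi>'. \<xi> \<in> trajectories M \<and> \<xi>' \<in> trajectories M \<and> ?R \<xi>' < ?R \<xi>}.
        0 \<le> w \<bullet> v)}"
    unfolding H_comparison_def by blast
  then show ?thesis
    by (simp only: compact_unit_ball_Int_dual_cone)
qed

lemma compact_H_correction: "compact (H_correction M \<phi> wstar)"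
proof -
  let ?F = "discounted_features M \<phi>" and ?R = "traj_return M \<phi> wstar"
  have "H_correction M \<phi> wstar = {w. norm w \<le> 1 \<and>
     (\<forall>v\<in>{?F \<xi> - ?F \<xi>' |\<xi> \<xi>'. \<xi> \<in> trajectories M \<and> \<xi>' \<in> trajectories M \<and>
             initial_state \<xi> = initial_state \<xi>' \<and> ?R \<xi>' < ?R \<xi>}.
        0 \<le> w \<bullet> v)}"
    unfolding H_correction_def by blast
  then show ?thesis
    by (simp only: compact_unit_ball_Int_dual_cone)
qed

lemma H_comparison_subset_H_correction: "H_comparison M \<phi> wstar \<subseteq> H_correction M \<phi> wstar"
  unfolding H_comparison_def H_correction_def by blast

theorem proposition2:
  fixes M :: "('s::finite, 'a::finite) mdp"
    and \<phi> :: "'s \<times> 'a \<Rightarrow> real ^ 'd"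
    and wstar :: "real ^ 'd"
  assumes mdp: "finite_mdp M"
    and generic:
      "\<exists>\<xi>i\<in>trajectories M. \<exists>\<xi>j\<in>trajectories M.
         traj_return M \<phi> wstar \<xi>i > traj_return M \<phi> wstar \<xi>j \<and>
         emeasure lebesgue
           (H_correction M \<phi> wstar \<inter>
            {w. w \<bullet> (discounted_features M \<phi> \<xi>i - discounted_features M \<phi> \<xi>j) < 0}) > 0"
  shows "H_comparison M \<phi> wstar \<subset> H_correction M \<phi> wstar
    \<and> G (H_comparison M \<phi> wstar) < G (H_correction M \<phi> wstar)"
proof -
  let ?A = "H_comparison M \<phi> wstar" and ?B = "H_correction M \<phi> wstar"
  obtain \<xi> \<xi>' where traj: "\<xi> \<in> trajectories M" "\<xi>' \<in> trajectories M"
      and better: "traj_return M \<phi> wstar \<xi>' < traj_return M \<phi> wstar \<xi>"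
      and pos: "0 < emeasure lebesgue
        (?B \<inter> {w. w \<bullet> (discounted_features M \<phi> \<xi> - discounted_features M \<phi> \<xi>') < 0})"
    using generic by blast
  let ?N = "{w. w \<bullet> (discounted_features M \<phi> \<xi> - discounted_features M \<phi> \<xi>') < 0}"
  have A: "?A \<in> lmeasurable" and B: "?B \<in> lmeasurable"
    by (simp_all add: compact_H_comparison compact_H_correction lmeasurable_compact)
  have "\<forall>w\<in>?A. 0 \<le> w \<bullet> (discounted_features M \<phi> \<xi> - discounted_features M \<phi> \<xi>')"
    using traj better unfolding H_comparison_def by blast
  \<comment> \<open>A point of \<open>?A\<close> in \<open>?N\<close> would have an inner product
    both nonnegative and negative.\<close>
  then have "?B \<inter> ?N \<subseteq> ?B - ?A"
    by force
  then have "0 < emeasure lebesgue (?B - ?A)"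
    using A B by (intro less_le_trans[OF pos] emeasure_mono) auto
  \<comment> \<open>Finiteness matters here: on a set of infinite measure the real-valued
    \<open>measure\<close> would be 0.\<close>
  then have "0 < measure lebesgue (?B - ?A)"
    using A B fmeasurable.Diff[OF B A] by (simp add: emeasure_eq_measure2 ennreal_less_zero_iff)
  also have "measure lebesgue (?B - ?A) = G ?B - G ?A"
    unfolding G_def
    by (rule measurable_measure_Diff[OF B fmeasurableD[OF A] H_comparison_subset_H_correction])
  finally have "G ?A < G ?B"
    by simp
  \<comment> \<open>Equal regions would have equal volume, so the inclusion is strict.\<close>
  then show ?thesis
    using H_comparison_subset_H_correction by (auto simp: psubset_eq)
qed

end
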